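(* Let $n\ge 1$, let $0\le a_1\le\dots\le a_n$ and $0\le b_1\le\dots\le b_n$ be non-decreasing sequences of real numbers, and let $x_1\ge x_2\ge\dots\ge x_n\ge 0$ (the singular values $\sigma_i(X)$ of a matrix $X$). For $s\ge 0$ put $$f_i(s)=\min\{b_i,[s-a_i]_+^2\}-(s-x_i)^2+s^2-[s-a_i]_+^2 .$$ Then Algorithm 1 (described in the context), run on the input $(a_i)$, $(b_i)$, $(x_i)$, terminates and returns a maximizing sequence, i.e. a vector $(\sigma_1,\dots,\sigma_n)$ with $\sigma_1\ge\dots\ge\sigma_n\ge 0$ such that $$\sum_{i=1}^n f_i(\sigma_i)=\max_{z_1\ge z_2\ge\dots\ge z_n\ge 0}\ \sum_{i=1}^n f_i(z_i).$$
   Context: Notation: $[t]_+=\max\{t,0\}$. A vector $(\sigma_1,\dots,\sigma_n)$ is a valid singular value vector if $\sigma_1\ge\dots\ge\sigma_n\ge 0$. Algorithm 1. Initialization: set $\sigma_i=a_i+\max\{\sqrt{b_i},x_i\}$ for $i=1,\dots,n$ (an unconstrained maximizer of $f_i$). While $(\sigma_1,\dots,\sigma_n)$ is not a valid singular value vector, do the following. Using the local extrema of the current sequence, form the subintervals $\iota\subseteq\{1,\dots,n\}$ on which the current sequence goes in a non-decreasing way from one local extremum to the next; that is, $\iota=\{p,p+1,\dots,q\}$ with $p<q$ ranges over all maximal sets of consecutive indices with $\sigma_p\le\sigma_{p+1}\le\dots\le\sigma_q$. For each such subinterval $\iota$, choose a scalar $s^*\in\arg\max_{s\ge 0}\sum_{i\in\iota}f_i(s)$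 and set $\sigma_i=s^*$ for all $i\in\iota$. Entries not in any such subinterval are left unchanged. When the loop stops, output $(\sigma_1,\dots,\sigma_n)$. *)

theory Defs
  imports Complex_Main
begin

definition pos_part :: "real \<Rightarrow> real" where
  "pos_part t = max t 0"

definition objective ::
    "(nat \<Rightarrow> real) \<Rightarrow> (nat \<Rightarrow> real) \<Rightarrow> (nat \<Rightarrow> real) \<Rightarrow> nat \<Rightarrow> real \<Rightarrow> real" where
  "objective a b x i s =
     min (b i) ((pos_part (s - a i))\<^sup>2) - (s - x i)\<^sup>2 + s\<^sup>2 - (pos_part (s - a i))\<^sup>2"

(* A vector of length n is a function on nat of which only the values on {1..n} matter. *)

definition valid_sv :: "nat \<Rightarrow> (nat \<Rightarrow> real) \<Rightarrow> bool" where
  "valid_sv n \<sigma> \<longleftrightarrow> antimono_on {1..n} \<sigma> \<and> (\<forall>i\<in>{1..n}. 0 \<le> \<sigma> i)"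

definition nondecreasing_runs :: "nat \<Rightarrow> (nat \<Rightarrow> real) \<Rightarrow> nat set set" where
  "nondecreasing_runs n \<sigma> =
     {{p..q} | p q. 1 \<le> p \<and> p < q \<and> q \<le> n \<and> mono_on {p..q} \<sigma> \<and>
        (\<forall>p' q'. 1 \<le> p' \<and> q' \<le> n \<and> {p..q} \<subseteq> {p'..q'} \<and> mono_on {p'..q'} \<sigma>
           \<longrightarrow> {p'..q'} = {p..q})}"

definition alg_init ::
    "(nat \<Rightarrow> real) \<Rightarrow> (nat \<Rightarrow> real) \<Rightarrow> (nat \<Rightarrow> real) \<Rightarrow> nat \<Rightarrow> real" where
  "alg_init a b x i = a i + max (sqrt (b i)) (x i)"

(* One pass of the while loop, guard included. It is a relation, not a function, since the
   maximizer s need not be unique; each run makes its own choice. *)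

definition alg_step ::
    "nat \<Rightarrow> (nat \<Rightarrow> real \<Rightarrow> real) \<Rightarrow> (nat \<Rightarrow> real) \<Rightarrow> (nat \<Rightarrow> real) \<Rightarrow> bool" where
  "alg_step n f \<sigma> \<sigma>' \<longleftrightarrow>
     \<not> valid_sv n \<sigma> \<and>
     (\<forall>\<iota>\<in>nondecreasing_runs n \<sigma>.
        \<exists>s. is_arg_max (\<lambda>s. \<Sum>i\<in>\<iota>. f i s) (\<lambda>s. 0 \<le> s) s \<and> (\<forall>i\<in>\<iota>. \<sigma>' i = s)) \<and>
     (\<forall>i. i \<notin> \<Union>(nondecreasing_runs n \<sigma>) \<longrightarrow> \<sigma>' i = \<sigma> i)"

(* Termination for every choice of maximizers: there is no infinite execution, and the loop
   body can always be carried out while the guard holds (the required maximizers exist). *)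

definition alg_terminates ::
    "nat \<Rightarrow> (nat \<Rightarrow> real \<Rightarrow> real) \<Rightarrow> (nat \<Rightarrow> real) \<Rightarrow> bool" where
  "alg_terminates n f \<sigma>\<^sub>0 \<longleftrightarrow>
     (\<nexists>\<tau>. \<tau> 0 = \<sigma>\<^sub>0 \<and> (\<forall>k::nat. alg_step n f (\<tau> k) (\<tau> (Suc k)))) \<and>
     (\<forall>\<sigma>. (alg_step n f)\<^sup>*\<^sup>* \<sigma>\<^sub>0 \<sigma> \<and> \<not> valid_sv n \<sigma> \<longrightarrow> (\<exists>\<sigma>'. alg_step n f \<sigma> \<sigma>'))"

definition alg_output ::
    "nat \<Rightarrow> (nat \<Rightarrow> real \<Rightarrow> real) \<Rightarrow> (nat \<Rightarrow> real) \<Rightarrow> (nat \<Rightarrow> real) \<Rightarrow> bool" where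
  "alg_output n f \<sigma>\<^sub>0 \<sigma> \<longleftrightarrow> (alg_step n f)\<^sup>*\<^sup>* \<sigma>\<^sub>0 \<sigma> \<and> valid_sv n \<sigma>"

end

theory Submission
  imports Defs "HOL-Analysis.Convex"
begin

text \<open>
  Each \<open>f\<^sub>i\<close> is concave, so the algorithm is a pool-adjacent-violators scheme. Call \<open>\<sigma>\<close>
  level optimal if it maximizes \<open>\<Sum>i. f\<^sub>i (y\<^sub>i)\<close> over all nonnegative \<open>y\<close> that are
  non-increasing on every level block of \<open>\<sigma>\<close>. The initial vector is level optimal, and for a
  valid \<open>\<sigma>\<close> level optimality gives the claim. A pass preserves it: let \<open>y\<close> be a competitor of
  the new vector. On a non-decreasing run of \<open>\<sigma>\<close> it is non-increasing, so some constant \<open>c\<close>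
  lies between \<open>\<sigma>\<^sub>i\<close> and \<open>y\<^sub>i\<close> for all \<open>i\<close> in the run. Concavity yields
  \<open>f\<^sub>i (y\<^sub>i) - f\<^sub>i c \<le> f\<^sub>i (\<sigma>\<^sub>i + y\<^sub>i - c) - f\<^sub>i (\<sigma>\<^sub>i)\<close>, and by level optimality of \<open>\<sigma>\<close> the right-hand
  sides have a nonpositive sum. So the constant \<open>c\<close>, hence also the maximizer chosen on the run, is
  at least as good as \<open>y\<close>. The loop stops because equal neighbours stay equal while every pass makes
  at least one further pair of neighbours equal.
\<close>

section \<open>Monotone sequences on integer intervals\<close>

lemma mono_on_atLeastAtMost_iff_Suc:
  fixes \<sigma> :: "nat \<Rightarrow> 'a::preorder"
  shows "mono_on {p..q} \<sigma> \<longleftrightarrow> (\<forall>i. p \<le> i \<and> i < q \<longrightarrow> \<sigma> i \<le> \<sigma> (Suc i))"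
proof
  assume step: "\<forall>i. p \<le> i \<and> i < q \<longrightarrow> \<sigma> i \<le> \<sigma> (Suc i)"
  have "\<sigma> i \<le> \<sigma> j" if "p \<le> i" "i \<le> j" "j \<le> q" for i j
    using that(2,3)
  proof (induction j rule: dec_induct)
    case (step k)
    then show ?case
      using \<open>\<forall>i. _ i\<close> that(1) by (metis Suc_leD Suc_le_lessD le_trans order_trans)
  qed simp
  then show "mono_on {p..q} \<sigma>"
    by (auto intro!: mono_onI)
qed (auto simp: mono_on_def)

lemma antimono_on_atLeastAtMost_iff_Suc:
  fixes \<sigma> :: "nat \<Rightarrow> real"
  shows "antimono_on {p..q} \<sigma> \<longleftrightarrow> (\<forall>i. p \<le> i \<and> i < q \<longrightarrow> \<sigma> (Suc i) \<le> \<sigma> i)"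
proof -
  have "antimono_on {p..q} \<sigma> \<longleftrightarrow> mono_on {p..q} (\<lambda>i. - \<sigma> i)"
    by (simp add: monotone_on_def)
  then show ?thesis
    by (simp add: mono_on_atLeastAtMost_iff_Suc)
qed

section \<open>Concavity, convexity and a separating constant\<close>

text \<open>The points \<open>u + d\<close> and \<open>v\<close> are convex combinations of
  \<open>u\<close> and \<open>v + d\<close> with the two weights swapped; adding the two concavity
  inequalities gives the claim.\<close>

lemma concave_on_increment_antimono:
  fixes f :: "real \<Rightarrow> real"
  assumes "concave_on S f" "u \<in> S" "v + d \<in> S" "u \<le> v" "0 \<le> d"
  shows "f (v + d) - f v \<le> f (u + d) - f u"
proof (cases "v + d = u")
  case False
  define L where "L = v + d - u"
  define \<theta> where "\<theta> = d / L"
  have L: "L > 0" and \<theta>: "0 \<le> \<theta>" "\<theta> \<le> 1"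
    using assms False by (auto simp: L_def \<theta>_def field_simps)
  have "\<theta> * L = d"
    using L by (simp add: \<theta>_def)
  then have ud: "(1 - \<theta>) *\<^sub>R u + \<theta> *\<^sub>R (v + d) = u + d"
    and v: "(1 - (1 - \<theta>)) *\<^sub>R u + (1 - \<theta>) *\<^sub>R (v + d) = v"
    by (auto simp: L_def algebra_simps)
  have "(1 - \<theta>) * f u + \<theta> * f (v + d) \<le> f (u + d)"
    using concave_onD[OF assms(1) \<theta> assms(2,3)] unfolding ud .
  moreover have "(1 - (1 - \<theta>)) * f u + (1 - \<theta>) * f (v + d) \<le> f v"
    using concave_onD[OF assms(1) _ _ assms(2,3), of "1 - \<theta>"] \<theta> unfolding v by simp
  ultimately show ?thesis
    by (simp add: algebra_simps)
next
  case True
  then have "d = 0" "v = u" using assms by auto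
  then show ?thesis by simp
qed

text \<open>The point \<open>m\<close> is a convex combination of \<open>t\<close> and
  \<open>s\<close>, and \<open>f s\<close> is the smaller end value. The case of interest is a
  maximizer \<open>t\<close>: to its right, \<open>f\<close> does not increase.\<close>

lemma concave_on_le_past_argmax:
  fixes f :: "real \<Rightarrow> real"
  assumes "concave_on S f" "t \<in> S" "s \<in> S" "f s \<le> f t" "t \<le> m" "m \<le> s"
  shows "f s \<le> f m"
proof (cases "t = s")
  case False
  define \<theta> where "\<theta> = (m - t) / (s - t)"
  have \<theta>: "0 \<le> \<theta>" "\<theta> \<le> 1" and "\<theta> * (s - t) = m - t"
    using assms False by (auto simp: \<theta>_def field_simps)
  then have m: "(1 - \<theta>) *\<^sub>R t + \<theta> *\<^sub>R s = m"
    by (simp add: algebra_simps)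
  have "(1 - \<theta>) * f s \<le> (1 - \<theta>) * f t"
    using \<theta> assms(4) by (intro mult_left_mono) auto
  then have "f s \<le> (1 - \<theta>) * f t + \<theta> * f s"
    by (simp add: algebra_simps)
  also have "\<dots> \<le> f m"
    using concave_onD[OF assms(1) \<theta> assms(2,3)] unfolding m .
  finally show ?thesis .
qed (use assms in auto)

lemma convex_on_max:
  assumes "convex_on S f" "convex_on S g"
  shows "convex_on S (\<lambda>s. max (f s) (g s))"
proof (rule convex_onI)
  fix t :: real and u v
  assume t: "0 < t" "t < 1" and uv: "u \<in> S" "v \<in> S"
  let ?m = "\<lambda>s. max (f s) (g s)"
  have "(1 - t) * f u + t * f v \<le> (1 - t) * ?m u + t * ?m v"
    "(1 - t) * g u + t * g v \<le> (1 - t) * ?m u + t * ?m v"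
    using t by (auto intro!: add_mono mult_left_mono)
  then show "?m ((1 - t) *\<^sub>R u + t *\<^sub>R v) \<le> (1 - t) * ?m u + t * ?m v"
    using convex_onD[OF assms(1) _ _ uv, of t] convex_onD[OF assms(2) _ _ uv, of t] t
    by simp
qed (use assms convex_on_imp_convex in auto)

lemma convex_on_power2:
  assumes "convex_on S f" "\<And>s. 0 \<le> f s"
  shows "convex_on S (\<lambda>s. (f s)\<^sup>2)"
proof (rule convex_onI)
  fix t :: real and u v
  assume t: "0 < t" "t < 1" and uv: "u \<in> S" "v \<in> S"
  have "f ((1 - t) *\<^sub>R u + t *\<^sub>R v) \<le> (1 - t) * f u + t * f v"
    using convex_onD[OF assms(1) _ _ uv] t by simp
  then have "(f ((1 - t) *\<^sub>R u + t *\<^sub>R v))\<^sup>2 \<le> ((1 - t) * f u + t * f v)\<^sup>2"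
    using assms(2) by (rule power_mono)
  also have "\<dots> \<le> (1 - t) * (f u)\<^sup>2 + t * (f v)\<^sup>2"
    using convex_onD[OF convex_power2, of t "f u" "f v"] t by simp
  finally show "(f ((1 - t) *\<^sub>R u + t *\<^sub>R v))\<^sup>2 \<le> (1 - t) * (f u)\<^sup>2 + t * (f v)\<^sup>2" .
qed (use assms convex_on_imp_convex in auto)

lemma mono_antimono_separator:
  fixes \<sigma> y :: "'i::linorder \<Rightarrow> 'a::linorder"
  assumes "finite A" "mono_on A \<sigma>" "antimono_on A y"
  obtains c where "\<And>i. i \<in> A \<Longrightarrow> min (\<sigma> i) (y i) \<le> c \<and> c \<le> max (\<sigma> i) (y i)"
proof (cases "A = {}")
  case False
  \<comment> \<open>Every lower bound \<open>min (\<sigma> k) (y k)\<close> is below every upper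
    bound \<open>max (\<sigma> i) (y i)\<close>: through \<open>\<sigma>\<close> if
    \<open>k \<le> i\<close>, through \<open>y\<close> otherwise. So the largest lower bound
    serves.\<close>
  define c where "c = Max ((\<lambda>i. min (\<sigma> i) (y i)) ` A)"
  have "min (\<sigma> i) (y i) \<le> c" if "i \<in> A" for i
    using that assms(1) by (simp add: c_def)
  moreover have "c \<le> max (\<sigma> i) (y i)" if "i \<in> A" for i
  proof -
    have "min (\<sigma> k) (y k) \<le> max (\<sigma> i) (y i)" if "k \<in> A" for k
    proof (cases "k \<le> i")
      case True
      then have "\<sigma> k \<le> \<sigma> i"
        using \<open>i \<in> A\<close> \<open>k \<in> A\<close> assms(2) by (auto dest: monotone_onD)
      then show ?thesis by (simp add: min.coboundedI1 max.coboundedI1)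
    next
      case False
      then have "y k \<le> y i"
        using \<open>i \<in> A\<close> \<open>k \<in> A\<close> assms(3) by (auto dest: monotone_onD)
      then show ?thesis by (simp add: min.coboundedI2 max.coboundedI2)
    qed
    then show ?thesis
      using assms(1) False by (simp add: c_def)
  qed
  ultimately show ?thesis using that by blast
qed (use that in blast)

section \<open>Maximal non-decreasing runs\<close>

lemma nondecreasing_runsE:
  assumes "\<iota> \<in> nondecreasing_runs n \<sigma>"
  obtains p q where "\<iota> = {p..q}" "1 \<le> p" "p < q" "q \<le> n" "mono_on {p..q} \<sigma>"
  using assms unfolding nondecreasing_runs_def by blast

lemma nondecreasing_runs_maximal:
  assumes "\<iota> \<in> nondecreasing_runs n \<sigma>"
    and "1 \<le> p" "q \<le> n" "\<iota> \<subseteq> {p..q}" "mono_on {p..q} \<sigma>"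
  shows "{p..q} = \<iota>"
proof -
  have "\<forall>p' q'. 1 \<le> p' \<and> q' \<le> n \<and> \<iota> \<subseteq> {p'..q'} \<and> mono_on {p'..q'} \<sigma> \<longrightarrow> {p'..q'} = \<iota>"
    using assms(1) unfolding nondecreasing_runs_def by blast
  then show ?thesis
    using assms(2-5) by blast
qed

text \<open>Two runs sharing an index glue together: each adjacent pair of their hull lies within
  one of them, so the hull is monotone and maximality identifies it with both.\<close>

lemma nondecreasing_runs_disjoint:
  assumes "\<iota> \<in> nondecreasing_runs n \<sigma>" "\<kappa> \<in> nondecreasing_runs n \<sigma>" "\<iota> \<inter> \<kappa> \<noteq> {}"
  shows "\<iota> = \<kappa>"
proof -
  obtain p q where \<iota>: "\<iota> = {p..q}" "1 \<le> p" "p < q" "q \<le> n" "mono_on {p..q} \<sigma>"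
    using assms(1) by (rule nondecreasing_runsE)
  obtain r t where \<kappa>: "\<kappa> = {r..t}" "1 \<le> r" "r < t" "t \<le> n" "mono_on {r..t} \<sigma>"
    using assms(2) by (rule nondecreasing_runsE)
  have "r \<le> q" "p \<le> t"
    using assms(3) by (auto simp: \<iota>(1) \<kappa>(1))
  then have "p \<le> i \<and> i < q \<or> r \<le> i \<and> i < t" if "min p r \<le> i" "i < max q t" for i
    using that \<iota>(3) \<kappa>(3) by linarith
  then have "mono_on {min p r..max q t} \<sigma>"
    using \<iota>(5) \<kappa>(5) unfolding mono_on_atLeastAtMost_iff_Suc by meson
  then have "{min p r..max q t} = \<iota>" "{min p r..max q t} = \<kappa>"
    using \<iota>(1,2,4) \<kappa>(1,2,4) by (intro nondecreasing_runs_maximal[of _ n \<sigma>] assms(1,2); auto)+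
  then show ?thesis
    by simp
qed

text \<open>Disjointness makes a definition by cases over the runs consistent. It supplies both the
  comparison sequence for level optimality and the successor state of a pass.\<close>

lemma nondecreasing_runs_piecewise:
  obtains g where "\<And>\<iota> i. \<iota> \<in> nondecreasing_runs n \<sigma> \<Longrightarrow> i \<in> \<iota> \<Longrightarrow> g i = C \<iota>"
    and "\<And>i. i \<notin> \<Union>(nondecreasing_runs n \<sigma>) \<Longrightarrow> g i = h i"
proof -
  let ?R = "nondecreasing_runs n \<sigma>"
  define g where "g i = (if i \<in> \<Union>?R then C (THE \<iota>. \<iota> \<in> ?R \<and> i \<in> \<iota>) else h i)" for i
  have "g i = C \<iota>" if "\<iota> \<in> ?R" "i \<in> \<iota>" for \<iota> i
  proof -
    have "(THE \<iota>. \<iota> \<in> ?R \<and> i \<in> \<iota>) = \<iota>"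
      using that nondecreasing_runs_disjoint by (intro the_equality) blast+
    then show ?thesis
      using that by (auto simp: g_def)
  qed
  then show ?thesis
    by (rule that) (auto simp: g_def)
qed

text \<open>Among the monotone intervals containing both indices, one of greatest length is maximal
  under inclusion.\<close>

lemma nondecreasing_runs_cover:
  assumes "1 \<le> i" "i < n" "\<sigma> i \<le> \<sigma> (Suc i)"
  obtains \<iota> where "\<iota> \<in> nondecreasing_runs n \<sigma>" "i \<in> \<iota>" "Suc i \<in> \<iota>"
proof -
  define W where "W = {(p, q). 1 \<le> p \<and> p \<le> i \<and> Suc i \<le> q \<and> q \<le> n \<and> mono_on {p..q} \<sigma>}"
  have "(i, Suc i) \<in> W"
    using assms by (auto simp: W_def mono_on_atLeastAtMost_iff_Suc le_Suc_eq dest: le_antisym)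
  \<comment> \<open>\<open>arg_max_nat_lemma\<close> asks for a strict bound on the measure, hence
    \<open>Suc n\<close>.\<close>
  moreover have "\<forall>v. v \<in> W \<longrightarrow> snd v - fst v < Suc n"
    by (auto simp: W_def)
  ultimately obtain w where w: "w \<in> W" "\<And>v. v \<in> W \<Longrightarrow> snd v - fst v \<le> snd w - fst w"
    using arg_max_nat_lemma[of "\<lambda>v. v \<in> W" _ "\<lambda>v. snd v - fst v"] by blast
  obtain p q where "w = (p, q)"
    by fastforce
  with w have pq: "1 \<le> p" "p \<le> i" "Suc i \<le> q" "q \<le> n" "mono_on {p..q} \<sigma>"
    and longest: "\<And>p' q'. (p', q') \<in> W \<Longrightarrow> q' - p' \<le> q - p"
    by (fastforce simp: W_def)+
  have "{p'..q'} = {p..q}"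
    if "1 \<le> p'" "q' \<le> n" "{p..q} \<subseteq> {p'..q'}" "mono_on {p'..q'} \<sigma>" for p' q'
  proof -
    have "p' \<le> p" "q \<le> q'"
      using that(3) pq(2,3) by auto
    moreover have "q' - p' \<le> q - p"
      using that pq calculation by (intro longest) (auto simp: W_def)
    ultimately have "p' = p" "q' = q"
      using pq(2,3) by linarith+
    then show ?thesis
      by simp
  qed
  then have "{p..q} \<in> nondecreasing_runs n \<sigma>"
    using pq unfolding nondecreasing_runs_def
    by (intro CollectI exI[of _ p] exI[of _ q]) auto
  then show ?thesis
    using that pq by simp
qed

lemma nondecreasing_run_subset: "\<iota> \<in> nondecreasing_runs n \<sigma> \<Longrightarrow> \<iota> \<subseteq> {1..n}"
  by (auto elim!: nondecreasing_runsE)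

section \<open>Level optimality and its preservation\<close>

text \<open>Level blocks are encoded by ties between neighbours, so a competitor obeys conditions on
  adjacent pairs only, and added ties can only shrink the set of competitors.\<close>

definition level_optimal ::
    "nat \<Rightarrow> (nat \<Rightarrow> real \<Rightarrow> real) \<Rightarrow> (nat \<Rightarrow> real) \<Rightarrow> bool" where
  "level_optimal n f \<sigma> \<longleftrightarrow> (\<forall>i\<in>{1..n}. 0 \<le> \<sigma> i) \<and>
     (\<forall>y. (\<forall>i\<in>{1..n}. 0 \<le> y i) \<and> (\<forall>i\<in>{1..<n}. \<sigma> i = \<sigma> (Suc i) \<longrightarrow> y (Suc i) \<le> y i)
        \<longrightarrow> (\<Sum>i=1..n. f i (y i)) \<le> (\<Sum>i=1..n. f i (\<sigma> i)))"

lemma alg_step_run: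
  assumes "alg_step n f \<sigma> \<sigma>'" "\<iota> \<in> nondecreasing_runs n \<sigma>"
  obtains s where "0 \<le> s" "\<And>t. 0 \<le> t \<Longrightarrow> (\<Sum>i\<in>\<iota>. f i t) \<le> (\<Sum>i\<in>\<iota>. f i s)"
    "\<And>i. i \<in> \<iota> \<Longrightarrow> \<sigma>' i = s"
proof -
  obtain s where "is_arg_max (\<lambda>s. \<Sum>i\<in>\<iota>. f i s) (\<lambda>s. 0 \<le> s) s" "\<forall>i\<in>\<iota>. \<sigma>' i = s"
    using assms unfolding alg_step_def by blast
  then show ?thesis
    by (intro that) (auto simp: is_arg_max_linorder)
qed

text \<open>Both indices lie in one run, which the pass makes constant. Hence ties survive and
  ascents become ties, which drives both preservation of optimality and termination.\<close>

lemma alg_step_merges: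
  assumes "alg_step n f \<sigma> \<sigma>'" "1 \<le> i" "i < n" "\<sigma> i \<le> \<sigma> (Suc i)"
  shows "\<sigma>' i = \<sigma>' (Suc i)"
proof -
  obtain \<iota> where \<iota>: "\<iota> \<in> nondecreasing_runs n \<sigma>" "i \<in> \<iota>" "Suc i \<in> \<iota>"
    using assms(2-4) by (rule nondecreasing_runs_cover)
  with alg_step_run[OF assms(1) \<iota>(1)] show ?thesis
    by metis
qed

lemma alg_step_nonneg:
  assumes "alg_step n f \<sigma> \<sigma>'" "0 \<le> \<sigma> i"
  shows "0 \<le> \<sigma>' i"
proof (cases "i \<in> \<Union>(nondecreasing_runs n \<sigma>)")
  case True
  then obtain \<iota> where \<iota>: "\<iota> \<in> nondecreasing_runs n \<sigma>" "i \<in> \<iota>"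
    by blast
  with alg_step_run[OF assms(1) \<iota>(1)] show ?thesis
    by metis
next
  case False
  then show ?thesis
    using assms unfolding alg_step_def by auto
qed

lemma level_optimal_step:
  assumes concave: "\<And>i. i \<in> {1..n} \<Longrightarrow> concave_on {0..} (f i)"
    and step: "alg_step n f \<sigma> \<sigma>'" and opt: "level_optimal n f \<sigma>"
  shows "level_optimal n f \<sigma>'"
  unfolding level_optimal_def
proof (intro conjI allI impI, goal_cases)
  case 1
  show ?case
    using opt alg_step_nonneg[OF step] unfolding level_optimal_def by blast
next
  case (2 y)
  let ?R = "nondecreasing_runs n \<sigma>"
  have nonneg: "0 \<le> \<sigma> i" "0 \<le> y i" if "i \<in> {1..n}" for i
    using that 2 opt unfolding level_optimal_def by blast+
  have "\<exists>c. \<forall>i\<in>\<iota>. min (\<sigma> i) (y i) \<le> c \<and> c \<le> max (\<sigma> i) (y i)" if run: "\<iota> \<in> ?R" for \<iota>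
  proof -
    obtain p q where pq: "\<iota> = {p..q}" "1 \<le> p" "p < q" "q \<le> n" "mono_on {p..q} \<sigma>"
      using run by (rule nondecreasing_runsE)
    \<comment> \<open>The run is part of a level block of \<open>\<sigma>'\<close>, so its
      competitor \<open>y\<close> is non-increasing there.\<close>
    have "y (Suc i) \<le> y i" if "p \<le> i" "i < q" for i
    proof -
      have "\<sigma> i \<le> \<sigma> (Suc i)"
        using that pq(5) by (simp add: mono_on_atLeastAtMost_iff_Suc)
      then have "\<sigma>' i = \<sigma>' (Suc i)"
        using that pq by (intro alg_step_merges[OF step]) auto
      then show ?thesis
        using that pq 2 by auto
    qed
    then have "antimono_on {p..q} y"
      by (simp add: antimono_on_atLeastAtMost_iff_Suc)
    then show ?thesis
      using mono_antimono_separator[of "{p..q}" \<sigma> y] pq(1,5) by (metis finite_atLeastAtMost)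
  qed
  then obtain C where C: "\<And>\<iota> i. \<iota> \<in> ?R \<Longrightarrow> i \<in> \<iota> \<Longrightarrow>
      min (\<sigma> i) (y i) \<le> C \<iota> \<and> C \<iota> \<le> max (\<sigma> i) (y i)"
    by metis
  obtain c where c_run: "\<And>\<iota> i. \<iota> \<in> ?R \<Longrightarrow> i \<in> \<iota> \<Longrightarrow> c i = C \<iota>"
    and c_off: "\<And>i. i \<notin> \<Union>?R \<Longrightarrow> c i = \<sigma> i"
    using nondecreasing_runs_piecewise[of n \<sigma> C \<sigma>] by metis
  have c_between: "min (\<sigma> i) (y i) \<le> c i" "c i \<le> max (\<sigma> i) (y i)" for i
    using C c_run by (cases "i \<in> \<Union>?R"; force simp: c_off)+
  \<comment> \<open>The move from \<open>c\<close> to \<open>y\<close> is transferred to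
    \<open>\<sigma>\<close>, which yields a competitor of the old vector.\<close>
  define w where "w i = \<sigma> i + (y i - c i)" for i
  have increment: "f i (y i) - f i (c i) \<le> f i (w i) - f i (\<sigma> i)" if "i \<in> {1..n}" for i
  proof (cases "\<sigma> i \<le> c i \<and> c i \<le> y i")
    case True
    then show ?thesis
      using concave_on_increment_antimono[OF concave[OF that], of "\<sigma> i" "c i" "y i - c i"] nonneg[OF that]
      by (simp add: w_def)
  next
    case False
    \<comment> \<open>The order is reversed; the increments compared now have length
      \<open>c i - y i\<close> and lead from \<open>y i\<close> to \<open>c i\<close> and from
      \<open>w i\<close> to \<open>\<sigma> i\<close>.\<close>
    then have "y i \<le> c i" "c i \<le> \<sigma> i"
      using c_between[of i] by linarith+
    then show ?thesis
      using concave_on_increment_antimono[OF concave[OF that], of "y i" "w i" "c i - y i"] nonneg[OF that]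
      by (simp add: w_def)
  qed
  \<comment> \<open>The upper bound on \<open>c i\<close> gives
    \<open>w i \<ge> min (\<sigma> i) (y i)\<close>.\<close>
  have "0 \<le> w i" if "i \<in> {1..n}" for i
    using c_between[of i] nonneg[OF that] by (simp add: w_def)
  \<comment> \<open>A tie of \<open>\<sigma>\<close> lies inside a run, where \<open>c\<close> is
    constant, and it survives the pass, so \<open>y\<close> does not increase across it.\<close>
  moreover have "w (Suc i) \<le> w i" if "i \<in> {1..<n}" "\<sigma> i = \<sigma> (Suc i)" for i
  proof -
    obtain \<iota> where "\<iota> \<in> ?R" "i \<in> \<iota>" "Suc i \<in> \<iota>"
      using nondecreasing_runs_cover[of i n \<sigma>] \<open>i \<in> {1..<n}\<close> \<open>\<sigma> i = \<sigma> (Suc i)\<close> by auto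
    then have "c i = c (Suc i)"
      using c_run by simp
    moreover have "y (Suc i) \<le> y i"
      using 2 that alg_step_merges[OF step, of i] by auto
    ultimately show ?thesis
      using that by (simp add: w_def)
  qed
  ultimately have "(\<Sum>i=1..n. f i (w i)) \<le> (\<Sum>i=1..n. f i (\<sigma> i))"
    using opt by (auto simp: level_optimal_def)
  moreover have "(\<Sum>i=1..n. f i (y i) - f i (c i)) \<le> (\<Sum>i=1..n. f i (w i) - f i (\<sigma> i))"
    by (intro sum_mono increment)
  ultimately have "(\<Sum>i=1..n. f i (y i)) \<le> (\<Sum>i=1..n. f i (c i))"
    by (simp add: sum_subtractf)
  also have "\<dots> \<le> (\<Sum>i=1..n. f i (\<sigma>' i))"
  proof -
    have split: "(\<Sum>i=1..n. g i) = (\<Sum>\<iota>\<in>?R. \<Sum>i\<in>\<iota>. g i) + (\<Sum>i\<in>{1..n} - \<Union>?R. g i)"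
      for g :: "nat \<Rightarrow> real"
    proof -
      have "(\<Sum>i\<in>\<Union>?R. g i) = (\<Sum>\<iota>\<in>?R. \<Sum>i\<in>\<iota>. g i)"
        using sum.Union_disjoint[of ?R g] nondecreasing_runs_disjoint[of _ n \<sigma>]
          finite_subset[OF nondecreasing_run_subset[of _ n \<sigma>]] by fastforce
      moreover have "\<Union>?R \<subseteq> {1..n}"
        using nondecreasing_run_subset by blast
      ultimately show ?thesis
        using sum.subset_diff[of "\<Union>?R" "{1..n}" g] by simp
    qed
    have "(\<Sum>i\<in>\<iota>. f i (c i)) \<le> (\<Sum>i\<in>\<iota>. f i (\<sigma>' i))" if run: "\<iota> \<in> ?R" for \<iota>
    proof -
      obtain s where s: "\<And>t. 0 \<le> t \<Longrightarrow> (\<Sum>i\<in>\<iota>. f i t) \<le> (\<Sum>i\<in>\<iota>. f i s)"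
        "\<And>i. i \<in> \<iota> \<Longrightarrow> \<sigma>' i = s"
        using alg_step_run[OF step run] by metis
      \<comment> \<open>A member of the run bounds \<open>C \<iota>\<close> below by a minimum of
        nonnegative values, so that \<open>C \<iota>\<close> is admissible for the maximizer
        \<open>s\<close>.\<close>
      obtain i where i: "i \<in> \<iota>"
        using run by (fastforce elim!: nondecreasing_runsE)
      then have "0 \<le> C \<iota>"
        using C[OF run i] nonneg[of i] nondecreasing_run_subset[OF run] by auto
      then show ?thesis
        using s c_run[OF run] by simp
    qed
    \<comment> \<open>Outside the runs both \<open>c\<close> and \<open>\<sigma>'\<close> agree with
      \<open>\<sigma>\<close>.\<close>
    moreover have "(\<Sum>i\<in>{1..n} - \<Union>?R. f i (c i)) = (\<Sum>i\<in>{1..n} - \<Union>?R. f i (\<sigma>' i))"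
      using step by (intro sum.cong) (auto simp: c_off alg_step_def)
    ultimately show ?thesis
      unfolding split by (simp add: sum_mono)
  qed
  finally show ?case .
qed

lemma level_optimal_reachable:
  assumes "\<And>i. i \<in> {1..n} \<Longrightarrow> concave_on {0..} (f i)"
    and "(alg_step n f)\<^sup>*\<^sup>* \<sigma>\<^sub>0 \<sigma>" "level_optimal n f \<sigma>\<^sub>0"
  shows "level_optimal n f \<sigma>"
  using assms(2,3) by induction (auto intro: level_optimal_step[OF assms(1)])

section \<open>Finiteness of every execution\<close>

lemma alg_step_not_infinite:
  assumes "\<And>i. i \<in> {1..n} \<Longrightarrow> 0 \<le> \<sigma>\<^sub>0 i"
  shows "\<nexists>\<tau>. \<tau> 0 = \<sigma>\<^sub>0 \<and> (\<forall>k::nat. alg_step n f (\<tau> k) (\<tau> (Suc k)))"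
proof
  assume "\<exists>\<tau>. \<tau> 0 = \<sigma>\<^sub>0 \<and> (\<forall>k::nat. alg_step n f (\<tau> k) (\<tau> (Suc k)))"
  then obtain \<tau> where \<tau>: "\<tau> 0 = \<sigma>\<^sub>0" and step: "\<And>k. alg_step n f (\<tau> k) (\<tau> (Suc k))"
    by blast
  define E where "E k = {i\<in>{1..<n}. \<tau> k i = \<tau> k (Suc i)}" for k
  have fin: "finite (E k)" for k
    by (simp add: E_def)
  have nonneg: "0 \<le> \<tau> k i" if "i \<in> {1..n}" for k i
    by (induction k) (use that assms \<tau> alg_step_nonneg[OF step] in auto)
  have "E k \<subset> E (Suc k)" for k
  proof
    show "E k \<subseteq> E (Suc k)"
      using alg_step_merges[OF step] by (auto simp: E_def)
    \<comment> \<open>Nonnegativity persists, so the guard can hold only because of a strict ascent;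
      the pass turns it into a new tie.\<close>
    have "\<not> antimono_on {1..n} (\<tau> k)"
      using step[of k] nonneg by (auto simp: alg_step_def valid_sv_def)
    then obtain i where i: "1 \<le> i" "i < n" "\<tau> k i < \<tau> k (Suc i)"
      by (auto simp: antimono_on_atLeastAtMost_iff_Suc not_le)
    then have "i \<in> E (Suc k)"
      using alg_step_merges[OF step, of i k] by (auto simp: E_def)
    moreover have "i \<notin> E k"
      using i by (simp add: E_def)
    ultimately show "E k \<noteq> E (Suc k)"
      by blast
  qed
  then have less: "card (E k) < card (E (Suc k))" for k
    using fin by (intro psubset_card_mono)
  have "k \<le> card (E k)" for k
    by (induction k) (use less in \<open>auto intro: Suc_leI le_less_trans\<close>)
  moreover have "card (E (Suc n)) \<le> card {1..<n}"
    by (rule card_mono) (auto simp: E_def)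
  ultimately have "Suc n \<le> card {1..<n}"
    using le_trans by blast
  then show False
    by simp
qed

section \<open>Existence of the maximizers chosen in a pass\<close>

text \<open>Beyond the largest individual maximizer \<open>m\<close>, no summand exceeds its value
  at \<open>m\<close>, so it suffices to maximize over the compact interval
  \<open>{0..m}\<close>.\<close>

lemma sum_concave_attains_max:
  fixes f :: "'i \<Rightarrow> real \<Rightarrow> real"
  assumes "finite I"
    and "\<And>i. i \<in> I \<Longrightarrow> concave_on {0..} (f i)"
    and "\<And>i. i \<in> I \<Longrightarrow> continuous_on {0..} (f i)"
    and "\<And>i. i \<in> I \<Longrightarrow> is_arg_max (f i) (\<lambda>s. 0 \<le> s) (t i)"
  obtains s where "is_arg_max (\<lambda>s. \<Sum>i\<in>I. f i s) (\<lambda>s. 0 \<le> s) s"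
proof -
  \<comment> \<open>Inserting \<open>0\<close> keeps \<open>Max\<close> meaningful for empty
    \<open>I\<close> and the interval \<open>{0..m}\<close> nonempty.\<close>
  define m where "m = Max (insert 0 (t ` I))"
  have m: "0 \<le> m" "\<And>i. i \<in> I \<Longrightarrow> t i \<le> m"
    using assms(1) by (auto simp: m_def)
  have "continuous_on {0..m} (\<lambda>s. \<Sum>i\<in>I. f i s)"
    using assms(3) by (intro continuous_on_sum continuous_on_subset[of "{0..}" _ "{0..m}"]) simp_all
  then obtain s where s: "s \<in> {0..m}" "\<And>u. u \<in> {0..m} \<Longrightarrow> (\<Sum>i\<in>I. f i u) \<le> (\<Sum>i\<in>I. f i s)"
    using continuous_attains_sup[of "{0..m}" "\<lambda>s. \<Sum>i\<in>I. f i s"] m(1)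
    by (metis atLeastatMost_empty_iff2 compact_Icc)
  have "(\<Sum>i\<in>I. f i u) \<le> (\<Sum>i\<in>I. f i s)" if "0 \<le> u" for u
  proof (cases "u \<le> m")
    case False
    have "f i u \<le> f i m" if "i \<in> I" for i
    proof -
      have "0 \<le> t i" "f i u \<le> f i (t i)"
        using assms(4)[OF that] \<open>0 \<le> u\<close> by (simp_all add: is_arg_max_linorder)
      then show ?thesis
        using concave_on_le_past_argmax[OF assms(2)[OF that], of "t i" u m] m(2)[OF that]
          \<open>0 \<le> u\<close> False by simp
    qed
    then have "(\<Sum>i\<in>I. f i u) \<le> (\<Sum>i\<in>I. f i m)"
      by (rule sum_mono)
    also have "\<dots> \<le> (\<Sum>i\<in>I. f i s)"
      using s m(1) by simp
    finally show ?thesis .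
  qed (use s that in auto)
  then show ?thesis
    using that s(1) by (auto simp: is_arg_max_linorder)
qed

lemma alg_step_exists:
  assumes "\<not> valid_sv n \<sigma>"
    and "\<And>\<iota>. \<iota> \<in> nondecreasing_runs n \<sigma> \<Longrightarrow> \<exists>s. is_arg_max (\<lambda>s. \<Sum>i\<in>\<iota>. f i s) (\<lambda>s. 0 \<le> s) s"
  shows "\<exists>\<sigma>'. alg_step n f \<sigma> \<sigma>'"
proof -
  let ?R = "nondecreasing_runs n \<sigma>"
  obtain S where S: "\<And>\<iota>. \<iota> \<in> ?R \<Longrightarrow> is_arg_max (\<lambda>s. \<Sum>i\<in>\<iota>. f i s) (\<lambda>s. 0 \<le> s) (S \<iota>)"
    using assms(2) by metis
  obtain \<sigma>' where "\<And>\<iota> i. \<iota> \<in> ?R \<Longrightarrow> i \<in> \<iota> \<Longrightarrow> \<sigma>' i = S \<iota>"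
    "\<And>i. i \<notin> \<Union>?R \<Longrightarrow> \<sigma>' i = \<sigma> i"
    using nondecreasing_runs_piecewise[of n \<sigma> S \<sigma>] by metis
  with assms(1) S have "alg_step n f \<sigma> \<sigma>'"
    unfolding alg_step_def by blast
  then show ?thesis
    by blast
qed

section \<open>Concavity and unconstrained maximizer of the objective\<close>

text \<open>The squares of \<open>s\<close> cancel and \<open>min b q - q = - max 0 (q - b)\<close>.
  In this form the objective is visibly an affine function minus a convex one.\<close>

lemma objective_altdef:
  "objective a b x i s = 2 * x i * s - (x i)\<^sup>2 - max 0 ((pos_part (s - a i))\<^sup>2 - b i)"
  by (simp add: objective_def power2_eq_square algebra_simps min_def max_def)

lemma concave_on_objective:
  assumes "convex S"
  shows "concave_on S (objective a b x i)"
proof -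
  have "convex_on S (\<lambda>s. s - a i)"
    using assms by (intro convex_on_diff) (simp_all add: convex_on_ident concave_on_const)
  then have "convex_on S (\<lambda>s. pos_part (s - a i))"
    unfolding pos_part_def using assms by (intro convex_on_max) (simp_all add: convex_on_const)
  then have "convex_on S (\<lambda>s. (pos_part (s - a i))\<^sup>2)"
    by (rule convex_on_power2) (simp add: pos_part_def)
  then have "convex_on S (\<lambda>s. max 0 ((pos_part (s - a i))\<^sup>2 - b i))"
    using assms by (intro convex_on_max convex_on_diff) (simp_all add: convex_on_const concave_on_const)
  moreover have "concave_on S (\<lambda>s. 2 * x i * s - (x i)\<^sup>2)"
    using assms by (simp add: concave_on_iff algebra_simps flip: distrib_right)
  ultimately show ?thesis
    unfolding objective_altdef by (rule concave_on_diff[rotated])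
qed

lemma continuous_on_objective: "continuous_on S (objective a b x i)"
  unfolding objective_def pos_part_def by (intro continuous_intros)

text \<open>Since \<open>s \<le> a i + u\<close> for the positive part \<open>u\<close> of
  \<open>s - a i\<close>, it suffices to maximize
  \<open>2 * x i * u - max 0 (u\<^sup>2 - r\<^sup>2)\<close> over \<open>u \<ge> 0\<close>, where
  \<open>r = sqrt (b i)\<close>. This is non-decreasing up to \<open>r\<close> and then a downward
  parabola with vertex \<open>x i\<close>, so \<open>max r (x i)\<close> is a maximizer.\<close>

lemma objective_le_alg_init:
  assumes "0 \<le> b i" "0 \<le> x i"
  shows "objective a b x i s \<le> objective a b x i (alg_init a b x i)"
proof -
  define r where "r = sqrt (b i)"
  have r: "0 \<le> r" "b i = r\<^sup>2"
    using assms by (simp_all add: r_def)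
  define u where "u = pos_part (s - a i)"
  have u: "0 \<le> u" "s \<le> a i + u"
    by (auto simp: u_def pos_part_def)
  have "2 * x i * s \<le> 2 * x i * (a i + u)"
    using u assms by (intro mult_left_mono) auto
  moreover have "2 * x i * u - max 0 (u\<^sup>2 - r\<^sup>2) \<le>
      2 * x i * max r (x i) - max 0 ((max r (x i))\<^sup>2 - r\<^sup>2)"
  proof (cases "x i \<le> r")
    case True
    then have max: "max r (x i) = r" by simp
    show ?thesis
    proof (cases "u \<le> r")
      case True
      then have "x i * u \<le> x i * r"
        using assms by (intro mult_left_mono)
      then show ?thesis
        unfolding max by (simp add: max_def)
    next
      case False
      \<comment> \<open>The product equals
        \<open>u\<^sup>2 - r\<^sup>2 - 2 * x i * (u - r)\<close>.\<close>
      have "0 \<le> (u - r) * (u + r - 2 * x i)"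
        using False True by (intro mult_nonneg_nonneg) auto
      then show ?thesis
        unfolding max by (simp add: max_def algebra_simps power2_eq_square)
    qed
  next
    case False
    then have "max r (x i) = x i" "r\<^sup>2 \<le> (x i)\<^sup>2"
      using r by (auto intro: power_mono)
    \<comment> \<open>The bound is the value of the left-hand side at \<open>u = x i\<close>; it
      comes from completing the square.\<close>
    moreover have "2 * x i * u - max 0 (u\<^sup>2 - r\<^sup>2) \<le> (x i)\<^sup>2 + r\<^sup>2"
    proof -
      have "2 * x i * u - (u\<^sup>2 - r\<^sup>2) \<le> (x i)\<^sup>2 + r\<^sup>2"
        using zero_le_power2[of "x i - u"] by (simp add: power2_diff)
      then show ?thesis
        by linarith
    qed
    ultimately show ?thesis
      by (simp add: power2_eq_square)
  qed
  moreover have "pos_part (alg_init a b x i - a i) = max r (x i)"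
    using r(1) by (auto simp: alg_init_def pos_part_def r_def[symmetric] max_def)
  ultimately show ?thesis
    unfolding objective_altdef u_def[symmetric] r(2) by (simp add: alg_init_def r_def algebra_simps)
qed

theorem theorem1:
  fixes n :: nat and a b x :: "nat \<Rightarrow> real"
  assumes "n \<ge> 1"
    and "0 \<le> a 1" and "mono_on {1..n} a"
    and "0 \<le> b 1" and "mono_on {1..n} b"
    and "antimono_on {1..n} x" and "0 \<le> x n"
  shows "alg_terminates n (objective a b x) (alg_init a b x) \<and>
    (\<forall>\<sigma>. alg_output n (objective a b x) (alg_init a b x) \<sigma> \<longrightarrow>
       valid_sv n \<sigma> \<and>
       (\<forall>z. valid_sv n z \<longrightarrow>
          (\<Sum>i=1..n. objective a b x i (z i)) \<le> (\<Sum>i=1..n. objective a b x i (\<sigma> i))))"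
proof -
  let ?f = "objective a b x" and ?init = "alg_init a b x"
  have nonneg: "0 \<le> a i" "0 \<le> b i" "0 \<le> x i" if "i \<in> {1..n}" for i
    using that assms monotone_onD[OF assms(3), of 1 i] monotone_onD[OF assms(5), of 1 i]
      monotone_onD[OF assms(6), of i n] by auto
  have init_nonneg: "0 \<le> ?init i" if "i \<in> {1..n}" for i
    using nonneg[OF that] by (simp add: alg_init_def max.coboundedI2)
  have init_max: "?f i s \<le> ?f i (?init i)" if "i \<in> {1..n}" for i s
    using nonneg[OF that] by (intro objective_le_alg_init)
  have concave: "concave_on {0..} (?f i)" for i
    by (simp add: concave_on_objective)
  have "level_optimal n ?f ?init"
    \<comment> \<open>The initial vector maximizes each summand separately.\<close>
    using init_nonneg init_max by (auto simp: level_optimal_def intro!: sum_mono)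
  then have reachable: "level_optimal n ?f \<sigma>" if "(alg_step n ?f)\<^sup>*\<^sup>* ?init \<sigma>" for \<sigma>
    using that concave by (blast intro: level_optimal_reachable)
  have "\<exists>s. is_arg_max (\<lambda>s. \<Sum>i\<in>\<iota>. ?f i s) (\<lambda>s. 0 \<le> s) s"
    if "\<iota> \<in> nondecreasing_runs n \<sigma>" for \<iota> \<sigma>
  proof -
    have \<iota>: "\<iota> \<subseteq> {1..n}"
      using that by (rule nondecreasing_run_subset)
    then have "is_arg_max (?f i) (\<lambda>s. 0 \<le> s) (?init i)" if "i \<in> \<iota>" for i
      using that init_nonneg init_max by (auto simp: is_arg_max_linorder)
    then show ?thesis
      using sum_concave_attains_max[of \<iota> ?f ?init] concave continuous_on_objective
        finite_subset[OF \<iota> finite_atLeastAtMost] by metis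
  qed
  then have "alg_terminates n ?f ?init"
    unfolding alg_terminates_def
    using alg_step_not_infinite[of n ?init ?f, OF init_nonneg] alg_step_exists[of n _ ?f] by blast
  moreover have "(\<Sum>i=1..n. ?f i (z i)) \<le> (\<Sum>i=1..n. ?f i (\<sigma> i))"
    if "alg_output n ?f ?init \<sigma>" "valid_sv n z" for \<sigma> z
  proof -
    have "level_optimal n ?f \<sigma>"
      using reachable that(1) by (simp add: alg_output_def)
    then show ?thesis
      \<comment> \<open>A valid \<open>z\<close> is non-increasing across all adjacent pairs, hence
        a competitor whatever the ties of \<open>\<sigma>\<close> are.\<close>
      using that(2) by (auto simp: level_optimal_def valid_sv_def antimono_on_atLeastAtMost_iff_Suc)
  qed
  ultimately show ?thesis
    by (auto simp: alg_output_def)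
qed

end
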